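(* For each integer $n\geq 2$ and each Latin square $L$ of order $n$, there exists a Latin square $L'\neq L$ of order $n$ such that $|L\setminus L'|\leq 8\sqrt{n}$.
   Context: For a positive integer $a$, $N(a)=\{0,1,\dots,a-1\}$. A Latin square of order $n$ is an $n\times n$ array, with rows and columns indexed by $N(n)$, in which each cell contains a symbol from $N(n)$ and each symbol occurs precisely once in each row and once in each column. A Latin square $L$ is identified with the set of ordered triples $(i,j,L(i,j))$, where $L(i,j)$ is the symbol in row $i$ and column $j$. Thus $|L\setminus L'|$ is the number of cells in which $L$ and $L'$ differ. *)

theory Defs
  imports Complex_Main
begin

text \<open>
  A Latin square is given by its set of triples (row, column, symbol). The first \<open>\<exists>!\<close> clause
  says that this set is an \<open>n \<times> n\<close> array (one symbol per cell), the other two that each symbol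
  occurs exactly once in each row and exactly once in each column.
\<close>

definition latin_square :: "nat \<Rightarrow> (nat \<times> nat \<times> nat) set \<Rightarrow> bool" where
  "latin_square n L \<longleftrightarrow>
     L \<subseteq> {..<n} \<times> {..<n} \<times> {..<n} \<and>
     (\<forall>i<n. \<forall>j<n. \<exists>!k. (i, j, k) \<in> L) \<and>
     (\<forall>i<n. \<forall>k<n. \<exists>!j. (i, j, k) \<in> L) \<and>
     (\<forall>j<n. \<forall>k<n. \<exists>!i. (i, j, k) \<in> L)"

end

theory Submission
  imports Defs "HOL-Combinatorics.Permutations"
begin

text \<open>
  Two rows \<open>r\<close>, \<open>r'\<close> of a Latin square \<open>A\<close> define a permutation of the columns: it sends \<open>e\<close> to the
  column in which row \<open>r\<close> has the symbol \<open>A r' e\<close>. Exchanging the two rows on the columns of one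
  cycle gives another Latin square, so a cycle of length \<open>O(\<surd>n)\<close>, for rows or for columns, settles
  the matter at once. The case of interest is that all cycles are long. Then one exchanges rows
  only along a piece of a cycle, and repairs the damage.

  Let \<open>c\<close>, \<open>c'\<close> be columns, and suppose that the permutation of \<open>r\<close>, \<open>r'\<close> takes \<open>c\<close> to \<open>c'\<close> in few
  steps. After the exchange of the two rows strictly between \<open>c\<close> and \<open>c'\<close> every other column is
  still correct, and the cells in columns \<open>c\<close>, \<open>c'\<close> have to be refilled with the pair
  \<open>{A r c, A r' c}\<close> in row \<open>r\<close> and \<open>{A r c', A r' c'}\<close> in row \<open>r'\<close>. View columns \<open>c\<close>, \<open>c'\<close> as a
  2-regular graph on the symbols, in which row \<open>i\<close> is the edge from \<open>A i c\<close> to \<open>A i c'\<close>; its directed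
  cycles are those of the permutation \<open>\<pi>\<close> of the rows that belongs to \<open>c\<close>, \<open>c'\<close>. The new pairs
  replace two edges \<open>p \<rightarrow> q\<close>, \<open>s \<rightarrow> t\<close> by \<open>ps\<close>, \<open>qt\<close>. As in a 2-opt move for the travelling salesman,
  the graph can again be oriented after the stretch of the cycle between the two edges has been
  reversed, that is, after columns \<open>c\<close> and \<open>c'\<close> have been exchanged in the rows of that stretch.
  This stretch may be long. But if one performs two such moves, for row pairs \<open>{u, v}\<close> and
  \<open>{u', v'}\<close> with \<open>u' = \<pi>\<^sup>d u\<close> and \<open>v = \<pi>\<^sup>d v'\<close>, then the two reversals cancel except on the two
  stretches from \<open>u\<close> to \<open>u'\<close> and from \<open>v'\<close> to \<open>v\<close>, of \<open>d\<close> steps each.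

  Such pairs exist by counting. For fixed \<open>c\<close> every ordered pair of rows reaches \<open>2k\<close> columns \<open>c'\<close>
  within about \<open>k\<close> steps in one direction or the other, so some \<open>c'\<close> is reached by at least \<open>2nk\<close>
  ordered pairs (\<open>many_joined_pairs\<close>). If \<open>2nk \<cdot> k > n\<^sup>2\<close>, the pigeonhole principle yields two of them
  in the required position with \<open>d < k\<close> (\<open>antiparallel_pair\<close>). The number of changed cells is at
  most \<open>4k\<close> for the rows and \<open>4k\<close> for the columns, and \<open>k = \<lfloor>\<surd>n\<rfloor>\<close> satisfies \<open>2k\<^sup>2 > n\<close> as soon as
  \<open>k \<ge> 4\<close>. For \<open>n \<le> 16\<close> it suffices to exchange two complete rows.
\<close>

section \<open>Latin squares as arrays, and partial exchanges\<close>

definition latin_array :: "nat \<Rightarrow> (nat \<Rightarrow> nat \<Rightarrow> nat) \<Rightarrow> bool" where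
  "latin_array n A \<longleftrightarrow>
     (\<forall>r<n. A r ` {..<n} = {..<n}) \<and> (\<forall>c<n. (\<lambda>r. A r c) ` {..<n} = {..<n})"

definition differing :: "nat \<Rightarrow> (nat \<Rightarrow> nat \<Rightarrow> nat) \<Rightarrow> (nat \<Rightarrow> nat \<Rightarrow> nat) \<Rightarrow> (nat \<times> nat) set" where
  "differing n A B = {(r, c). r < n \<and> c < n \<and> A r c \<noteq> B r c}"

definition near_latin :: "nat \<Rightarrow> (nat \<Rightarrow> nat \<Rightarrow> nat) \<Rightarrow> nat \<Rightarrow> bool" where
  "near_latin n A b \<longleftrightarrow>
     (\<exists>B. latin_array n B \<and> differing n A B \<noteq> {} \<and> card (differing n A B) \<le> b)"

definition transp :: "(nat \<Rightarrow> nat \<Rightarrow> nat) \<Rightarrow> nat \<Rightarrow> nat \<Rightarrow> nat" where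
  "transp A r c = A c r"

definition row_map :: "nat \<Rightarrow> (nat \<Rightarrow> nat \<Rightarrow> nat) \<Rightarrow> nat \<Rightarrow> nat \<Rightarrow> nat \<Rightarrow> nat" where
  "row_map n A r r' e = inv_into {..<n} (A r) (A r' e)"

text \<open>
  A set \<open>I\<close> of columns as it arises strictly between \<open>c\<close> and \<open>c'\<close> on a cycle of
  \<open>row_map n A r r'\<close>. The equation of images is all that is needed of such a path, and it makes no
  reference to iteration. Applied to the transposed array the same notion describes a stretch of
  rows between two rows.
\<close>

definition link :: "nat \<Rightarrow> (nat \<Rightarrow> nat \<Rightarrow> nat) \<Rightarrow> nat \<Rightarrow> nat \<Rightarrow> nat \<Rightarrow> nat \<Rightarrow> nat set \<Rightarrow> bool" where
  "link n A r r' c c' I \<longleftrightarrow>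
     I \<subseteq> {..<n} - {c, c'} \<and> A r' ` insert c I = A r ` insert c' I"

text \<open>
  The edges of the graph on the rows for a pair of columns. The direction of the path does not
  matter because it only decides which of the two rows receives which pair of symbols. The
  interior must be nonempty in order that the exchange changes something.
\<close>

definition joined :: "nat \<Rightarrow> (nat \<Rightarrow> nat \<Rightarrow> nat) \<Rightarrow> nat \<Rightarrow> nat \<Rightarrow> nat \<Rightarrow> nat \<Rightarrow> nat \<Rightarrow> bool" where
  "joined n A k c c' r r' \<longleftrightarrow>
     (\<exists>I. I \<noteq> {} \<and> card I \<le> k \<and> (link n A r r' c c' I \<or> link n A r' r c c' I))"

definition short_cycle :: "nat \<Rightarrow> (nat \<Rightarrow> nat \<Rightarrow> nat) \<Rightarrow> nat \<Rightarrow> bool" where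
  "short_cycle n A b \<longleftrightarrow>
     (\<exists>r<n. \<exists>r'<n. \<exists>e<n. \<exists>l. r \<noteq> r' \<and> 1 \<le> l \<and> l \<le> b \<and> (row_map n A r r' ^^ l) e = e)"

definition swap_cells :: "nat \<Rightarrow> nat \<Rightarrow> nat set \<Rightarrow> (nat \<Rightarrow> nat \<Rightarrow> nat) \<Rightarrow> nat \<Rightarrow> nat \<Rightarrow> nat" where
  "swap_cells r r' S A i e = (if e \<in> S then A (Transposition.transpose r r' i) e else A i e)"

text \<open>
  An array that becomes a Latin square when columns \<open>c\<close> and \<open>c'\<close> are refilled in such a way that
  row \<open>r\<close> receives the symbols \<open>P r\<close> and each of the two columns contains every symbol.
\<close>

definition fillable :: "nat \<Rightarrow> nat \<Rightarrow> nat \<Rightarrow> (nat \<Rightarrow> nat \<Rightarrow> nat) \<Rightarrow> (nat \<Rightarrow> nat set) \<Rightarrow> bool" where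
  "fillable n c c' M P \<longleftrightarrow>
     (\<forall>e<n. e \<notin> {c, c'} \<longrightarrow> {..<n} \<subseteq> (\<lambda>r. M r e) ` {..<n}) \<and>
     (\<forall>r<n. {..<n} \<subseteq> M r ` ({..<n} - {c, c'}) \<union> P r)"

lemma latin_array_inj:
  assumes "latin_array n A" "r < n"
  shows "inj_on (A r) {..<n}" "inj_on (\<lambda>c. A c r) {..<n}"
  using assms by (auto simp: latin_array_def intro!: eq_card_imp_inj_on)

lemma latin_array_less:
  assumes "latin_array n A" "r < n" "c < n"
  shows "A r c < n"
  using assms by (auto simp: latin_array_def)

lemma latin_array_transp: "latin_array n (transp A) \<longleftrightarrow> latin_array n A"
  by (auto simp: latin_array_def transp_def)

lemma near_latin_transp:
  assumes "near_latin n (transp A) b"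
  shows "near_latin n A b"
proof -
  obtain B where B: "latin_array n B" "differing n (transp A) B \<noteq> {}"
    "card (differing n (transp A) B) \<le> b"
    using assms by (auto simp: near_latin_def)
  have eq: "differing n A (transp B) = prod.swap ` differing n (transp A) B"
    by (force simp: differing_def transp_def)
  have "card (differing n A (transp B)) = card (differing n (transp A) B)"
    unfolding eq by (rule card_image) simp
  moreover have "latin_array n (transp B)"
    using B by (simp add: latin_array_transp)
  ultimately show ?thesis
    using B eq unfolding near_latin_def by (intro exI[of _ "transp B"]) auto
qed

section \<open>The permutation of the columns defined by two rows\<close>

lemma row_map:
  assumes "latin_array n A" "r < n" "r' < n"
  shows "bij_betw (row_map n A r r') {..<n} {..<n}"
    and "\<And>e. e < n \<Longrightarrow> A r (row_map n A r r' e) = A r' e"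
proof -
  have b: "bij_betw (A r) {..<n} {..<n}" "bij_betw (A r') {..<n} {..<n}"
    using assms latin_array_inj by (auto simp: bij_betw_def latin_array_def)
  have "bij_betw (inv_into {..<n} (A r) \<circ> A r') {..<n} {..<n}"
    using b bij_betw_inv_into bij_betw_trans by blast
  then show "bij_betw (row_map n A r r') {..<n} {..<n}"
    by (simp add: row_map_def[abs_def] comp_def)
  show "A r (row_map n A r r' e) = A r' e" if "e < n" for e
    unfolding row_map_def using assms that
    by (intro f_inv_into_f) (auto simp: latin_array_def)
qed

lemma row_map_inverse:
  assumes "latin_array n A" "r < n" "r' < n" "e < n"
  shows "row_map n A r r' (row_map n A r' r e) = e"
proof -
  have l: "row_map n A r' r e < n"
    using row_map(1)[of n A r' r] assms by (auto simp: bij_betw_def)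
  then have l2: "row_map n A r r' (row_map n A r' r e) < n"
    using row_map(1)[of n A r r'] assms by (auto simp: bij_betw_def)
  have "A r (row_map n A r r' (row_map n A r' r e)) = A r e"
    using row_map(2) assms l by metis
  then show ?thesis
    using latin_array_inj(1)[of n A r] assms l2 by (auto dest: inj_onD)
qed

lemma funpow_bij:
  fixes \<pi> :: "nat \<Rightarrow> nat"
  assumes "bij_betw \<pi> {..<n} {..<n}"
  shows "bij_betw (\<pi> ^^ i) {..<n} {..<n}"
  using assms by (induction i) (auto intro: bij_betw_trans)

lemma funpow_less:
  fixes \<pi> :: "nat \<Rightarrow> nat"
  assumes "bij_betw \<pi> {..<n} {..<n}" "e < n"
  shows "(\<pi> ^^ i) e < n"
  using funpow_bij[OF assms(1), of i] assms(2) by (auto simp: bij_betw_def)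

lemma funpow_inject:
  fixes \<pi> :: "nat \<Rightarrow> nat"
  assumes "bij_betw \<pi> {..<n} {..<n}" "e < n" "e' < n" "(\<pi> ^^ i) e = (\<pi> ^^ i) e'"
  shows "e = e'"
  using funpow_bij[OF assms(1), of i] assms by (auto simp: bij_betw_def dest: inj_onD)

lemma orbit_inj:
  fixes \<pi> :: "nat \<Rightarrow> nat"
  assumes "bij_betw \<pi> {..<n} {..<n}" "e < n"
    and nc: "\<And>l. 1 \<le> l \<Longrightarrow> l \<le> b \<Longrightarrow> (\<pi> ^^ l) e \<noteq> e"
  shows "inj_on (\<lambda>j. (\<pi> ^^ j) e) {..b}"
proof (rule linorder_inj_onI)
  fix i j assume ij: "i < j" "i \<in> {..b}" "j \<in> {..b}"
  show "(\<pi> ^^ i) e \<noteq> (\<pi> ^^ j) e"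
  proof
    assume "(\<pi> ^^ i) e = (\<pi> ^^ j) e"
    also have "(\<pi> ^^ j) e = (\<pi> ^^ i) ((\<pi> ^^ (j - i)) e)"
      using ij funpow_add[of i "j - i" \<pi>] by simp
    finally have "e = (\<pi> ^^ (j - i)) e"
      using funpow_inject funpow_less assms by metis
    moreover have "1 \<le> j - i" "j - i \<le> b" using ij by auto
    ultimately show False using nc by metis
  qed
qed auto

text \<open>
  Shifting the orbit segment \<open>c, \<pi> c, \<dots>, \<pi>\<^sup>J\<^sup>-\<^sup>1 c\<close> by one step gives the segment that ends in \<open>\<pi>\<^sup>J c\<close>.
\<close>

lemma orbit_link:
  fixes \<pi> :: "nat \<Rightarrow> nat"
  assumes bij: "bij_betw \<pi> {..<n} {..<n}" and PQ: "\<And>e. e < n \<Longrightarrow> P (\<pi> e) = Q e"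
    and "c < n" "1 \<le> J"
  shows "Q ` insert c ((\<lambda>j. (\<pi> ^^ j) c) ` {1..<J}) = P ` insert ((\<pi> ^^ J) c) ((\<lambda>j. (\<pi> ^^ j) c) ` {1..<J})"
proof -
  have 1: "insert c ((\<lambda>j. (\<pi> ^^ j) c) ` {1..<J}) = (\<lambda>j. (\<pi> ^^ j) c) ` {0..<J}"
  proof -
    have "{0..<J} = insert 0 {1..<J}" using \<open>1 \<le> J\<close> by auto
    then show ?thesis by (metis (no_types, lifting) funpow_0 image_insert)
  qed
  have 2: "insert ((\<pi> ^^ J) c) ((\<lambda>j. (\<pi> ^^ j) c) ` {1..<J}) = \<pi> ` (\<lambda>j. (\<pi> ^^ j) c) ` {0..<J}"
  proof -
    have "\<pi> ` (\<lambda>j. (\<pi> ^^ j) c) ` {0..<J} = (\<lambda>j. (\<pi> ^^ j) c) ` Suc ` {0..<J}"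
      by (simp only: image_image funpow.simps comp_apply)
    also have "Suc ` {0..<J} = insert J {1..<J}" using \<open>1 \<le> J\<close> by auto
    finally show ?thesis by simp
  qed
  have "Q ((\<pi> ^^ j) c) = P (\<pi> ((\<pi> ^^ j) c))" for j
    using PQ funpow_less[OF bij \<open>c < n\<close>] by simp
  then show ?thesis
    unfolding 1 2 by (simp add: image_image)
qed

lemma link_of_orbit:
  assumes L: "latin_array n A" and r: "r < n" "r' < n" "r \<noteq> r'" and c: "c < n"
    and ns: "\<not> short_cycle n A b" and J: "1 \<le> J" "J \<le> b"
  shows "link n A r r' c ((row_map n A r r' ^^ J) c) ((\<lambda>j. (row_map n A r r' ^^ j) c) ` {1..<J})"
proof -
  let ?\<pi> = "row_map n A r r'"
  note bij = row_map(1)[OF L r(1,2)]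
  have inj: "inj_on (\<lambda>j. (?\<pi> ^^ j) c) {..b}"
    using ns r c by (intro orbit_inj[OF bij c]) (auto simp: short_cycle_def)
  have "(?\<pi> ^^ j) c \<noteq> (?\<pi> ^^ i) c" if "j \<in> {1..<J}" "i = 0 \<or> i = J" for i j
    using inj_onD[OF inj, of j i] that J by auto
  from this[of _ 0] this[of _ J] have "(\<lambda>j. (?\<pi> ^^ j) c) ` {1..<J} \<subseteq> {..<n} - {c, (?\<pi> ^^ J) c}"
    using funpow_less[OF bij c] by auto
  then show ?thesis
    using orbit_link[where P = "A r" and Q = "A r'", OF bij row_map(2)[OF L r(1,2)] c J(1)]
    by (simp add: link_def)
qed

text \<open>
  The permutation of \<open>r\<close>, \<open>r'\<close> and its inverse, which is that of \<open>r'\<close>, \<open>r\<close>, each reach \<open>k\<close> columns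
  in \<open>2, \<dots>, k + 1\<close> steps. These are \<open>2k\<close> distinct columns since a coincidence would close a cycle of
  length at most \<open>2k + 2\<close>. One step is excluded because then the interior of the path is empty.
\<close>

lemma card_joined:
  assumes L: "latin_array n A" and r: "r < n" "r' < n" "r \<noteq> r'" and c: "c < n"
    and ns: "\<not> short_cycle n A (2 * k + 2)"
  shows "2 * k \<le> card {c' \<in> {..<n} - {c}. joined n A k c c' r r'}"
proof -
  let ?\<pi> = "row_map n A r r'" and ?\<rho> = "row_map n A r' r"
  let ?f = "\<lambda>j. (?\<pi> ^^ j) c" and ?g = "\<lambda>j. (?\<rho> ^^ j) c"
  note bp = row_map(1)[OF L r(1,2)] and br = row_map(1)[OF L r(2,1)]
  have injf: "inj_on ?f {..2*k+2}" and injg: "inj_on ?g {..2*k+2}"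
    using ns r c by (intro orbit_inj[OF bp c] orbit_inj[OF br c]; auto simp: short_cycle_def)+
  have inverse: "(?\<pi> ^^ j) (?g j) = c" for j
  proof (induction j)
    case (Suc j)
    have "(?\<pi> ^^ Suc j) (?g (Suc j)) = (?\<pi> ^^ j) (?\<pi> (?\<rho> (?g j)))"
      by (simp add: funpow_swap1)
    also have "\<dots> = c"
      using Suc row_map_inverse[OF L r(1,2)] funpow_less[OF br c] by simp
    finally show ?case .
  qed simp
  have disj: "?f ` {2..k+1} \<inter> ?g ` {2..k+1} = {}"
  proof (rule ccontr)
    assume "\<not> ?thesis"
    then obtain i j where ij: "i \<in> {2..k+1}" "j \<in> {2..k+1}" "?f i = ?g j" by blast
    then have "?f (j + i) = c" using inverse[of j] by (simp add: funpow_add)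
    then show False
      using inj_onD[OF injf, of "j + i" 0] ij by auto
  qed
  have "2 * k = card (?f ` {2..k+1}) + card (?g ` {2..k+1})"
    using inj_on_subset[OF injf, of "{2..k+1}"] inj_on_subset[OF injg, of "{2..k+1}"]
    by (simp add: card_image)
  also have "\<dots> = card (?f ` {2..k+1} \<union> ?g ` {2..k+1})"
    using disj by (simp add: card_Un_disjoint)
  also have "\<dots> \<le> card {c' \<in> {..<n} - {c}. joined n A k c c' r r'}"
  proof (rule card_mono)
    have "?f j \<noteq> c" "?g j \<noteq> c" if "j \<in> {2..k+1}" for j
      using inj_onD[OF injf, of j 0] inj_onD[OF injg, of j 0] that by auto
    moreover have "joined n A k c (?f j) r r'" "joined n A k c (?g j) r r'" if "j \<in> {2..k+1}" for j
    proof -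
      have small: "card (h ` {1..<j}) \<le> k" "h ` {1..<j} \<noteq> {}" for h :: "nat \<Rightarrow> nat"
        using that card_image_le[of "{1..<j}" h] by auto
      have "link n A r r' c (?f j) (?f ` {1..<j})"
        by (rule link_of_orbit[OF L r c ns]) (use that in auto)
      then show "joined n A k c (?f j) r r'"
        unfolding joined_def using small[of ?f] by (intro exI[of _ "?f ` {1..<j}"] conjI disjI1)
      have "link n A r' r c (?g j) (?g ` {1..<j})"
        by (rule link_of_orbit[OF L r(2,1) r(3)[symmetric] c ns]) (use that in auto)
      then show "joined n A k c (?g j) r r'"
        unfolding joined_def using small[of ?g] by (intro exI[of _ "?g ` {1..<j}"] conjI disjI2)
    qed
    ultimately show "?f ` {2..k+1} \<union> ?g ` {2..k+1} \<subseteq> {c' \<in> {..<n} - {c}. joined n A k c c' r r'}"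
      using funpow_less[OF bp c] funpow_less[OF br c]
      by (intro Un_least image_subsetI CollectI conjI DiffI) simp_all
  qed simp
  finally show ?thesis .
qed

section \<open>Finding two row pairs in antiparallel position\<close>

text \<open>
  Move \<open>u\<close> forward by \<open>i\<close> steps and \<open>v\<close> by \<open>m - i\<close> steps, for \<open>i = 0, \<dots>, m\<close>. The hypothesis makes two
  of the resulting pairs of rows coincide, with different \<open>i\<close> and \<open>i'\<close>, and then \<open>d\<close> is the
  difference of \<open>i\<close> and \<open>i'\<close>. Counting \<open>m - i\<close> for \<open>v\<close> makes the two displacements opposite and
  avoids the inverse of \<open>\<pi>\<close>.
\<close>

lemma antiparallel_pair:
  fixes \<pi> :: "nat \<Rightarrow> nat"
  assumes bij: "bij_betw \<pi> {..<n} {..<n}" and E: "E \<subseteq> {..<n} \<times> {..<n}"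
    and big: "n * n < card E * (m + 1)"
  shows "\<exists>u v u' v' d. (u, v) \<in> E \<and> (u', v') \<in> E \<and> 1 \<le> d \<and> d \<le> m \<and>
           u' = (\<pi> ^^ d) u \<and> v = (\<pi> ^^ d) v'"
proof -
  define \<Phi> where "\<Phi> = (\<lambda>((u, v), i). ((\<pi> ^^ i) u, (\<pi> ^^ (m - i)) v))"
  have sub: "\<Phi> ` (E \<times> {..m}) \<subseteq> {..<n} \<times> {..<n}"
    using E funpow_less[OF bij] by (force simp: \<Phi>_def)
  have "\<not> inj_on \<Phi> (E \<times> {..m})"
  proof
    assume "inj_on \<Phi> (E \<times> {..m})"
    then have "card (E \<times> {..m}) \<le> card ({..<n} \<times> {..<n})"
      using sub by (rule card_inj_on_le) simp
    then show False using big by (simp add: card_cartesian_product)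
  qed
  then obtain p q where pq: "p \<in> E \<times> {..m}" "q \<in> E \<times> {..m}" "\<Phi> p = \<Phi> q" "p \<noteq> q" 
    unfolding inj_on_def by blast
  define P where "P = (\<lambda>p q. p \<in> E \<times> {..m} \<and> q \<in> E \<times> {..m} \<and> \<Phi> p = \<Phi> q \<and> snd q < snd p)"
  have "P p q \<or> P q p"
  proof -
    have "snd p \<noteq> snd q"
    proof
      assume eq: "snd p = snd q"
      obtain u v i u' v' where [simp]: "p = ((u, v), i)" "q = ((u', v'), i)"
        using eq by (metis prod.collapse)
      have "u < n" "v < n" "u' < n" "v' < n" using pq E by auto
      then have "u = u'" "v = v'" using pq(3) funpow_inject[OF bij] by (auto simp: \<Phi>_def)
      then show False using pq(4) by simp
    qed
    then show ?thesis using pq unfolding P_def by auto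
  qed
  then obtain p q where "P p q" by blast
  then obtain u v i u' v' i' where *: "(u, v) \<in> E" "(u', v') \<in> E" "i \<le> m" "i' < i"
    "(\<pi> ^^ i) u = (\<pi> ^^ i') u'" "(\<pi> ^^ (m - i)) v = (\<pi> ^^ (m - i')) v'"
    unfolding P_def \<Phi>_def by (cases p; cases q) auto
  define d where "d = i - i'"
  have less: "u < n" "v < n" "u' < n" "v' < n" using * E by auto
  have "(\<pi> ^^ i') ((\<pi> ^^ d) u) = (\<pi> ^^ (i' + d)) u"
    by (simp add: funpow_add)
  also have "\<dots> = (\<pi> ^^ i') u'" using * by (simp add: d_def)
  finally have "u' = (\<pi> ^^ d) u"
    using funpow_inject[OF bij] funpow_less[OF bij] less by blast
  have "(\<pi> ^^ (m - i)) ((\<pi> ^^ d) v') = (\<pi> ^^ (m - i + d)) v'"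
    by (simp add: funpow_add)
  also have "m - i + d = m - i'" using * by (simp add: d_def)
  also have "(\<pi> ^^ (m - i')) v' = (\<pi> ^^ (m - i)) v" using * by simp
  finally have "v = (\<pi> ^^ d) v'"
    using funpow_inject[OF bij] funpow_less[OF bij] less by blast
  have "1 \<le> d" "d \<le> m" using * by (auto simp: d_def)
  show ?thesis
    by (intro exI[of _ u] exI[of _ v] exI[of _ u'] exI[of _ v'] exI[of _ d] conjI) fact+
qed


lemma joined_sym: "joined n A k c c' r r' \<longleftrightarrow> joined n A k c c' r' r"
  by (auto simp: joined_def)

lemma joinedE:
  assumes "joined n A k c c' x y"
  obtains r r' I where "r = x \<and> r' = y \<or> r = y \<and> r' = x" "link n A r r' c c' I" "I \<noteq> {}" "card I \<le> k"
  using assms unfolding joined_def by blast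

text \<open>
  An average over \<open>c'\<close>: the \<open>n(n - 1)\<close> ordered pairs of distinct rows are each counted for at least
  \<open>2k\<close> of the \<open>n - 1\<close> columns \<open>c' \<noteq> c\<close>.
\<close>

lemma many_joined_pairs:
  assumes L: "latin_array n A" and c: "c < n" and n: "2 \<le> n"
    and ns: "\<not> short_cycle n A (2 * k + 2)"
  shows "\<exists>c'<n. c' \<noteq> c \<and>
    2 * n * k \<le> card {(r, r'). r < n \<and> r' < n \<and> r \<noteq> r' \<and> joined n A k c c' r r'}"
proof (rule ccontr)
  define S where "S = {..<n} - {c}"
  define T where "T = {..<n} \<times> {..<n} - (\<lambda>r. (r, r)) ` {..<n}"
  define R where "R = (\<lambda>c' (r, r'). joined n A k c c' r r')"
  assume "\<not> ?thesis"
  moreover have "{(r, r'). r < n \<and> r' < n \<and> r \<noteq> r' \<and> joined n A k c c' r r'} = {p \<in> T. R c' p}" for c'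
    by (auto simp: T_def R_def)
  ultimately have less: "card {p \<in> T. R c' p} < 2 * n * k" if "c' \<in> S" for c'
    using that by (auto simp: S_def not_le)
  have fin: "finite S" "finite T" by (auto simp: S_def T_def)
  have "card T = card ({..<n} \<times> {..<n}) - card ((\<lambda>r. (r, r)) ` {..<n})"
    unfolding T_def by (rule card_Diff_subset) auto
  also have "\<dots> = n * n - n"
    by (simp add: card_cartesian_product card_image inj_on_def)
  finally have cards: "card S = n - 1" "card T = n * n - n"
    using c by (simp_all add: S_def)
  then have "S \<noteq> {}" using n by auto
  have "card T * (2 * k) = (\<Sum>p\<in>T. 2 * k)" by simp
  also have "\<dots> \<le> (\<Sum>p\<in>T. card {c' \<in> S. R c' p})"
    unfolding T_def S_def R_def using card_joined[OF L _ _ _ c ns]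
    by (intro sum_mono) auto
  also have "\<dots> = (\<Sum>c'\<in>S. card {p \<in> T. R c' p})"
    using fin by (intro sum_multicount_gen[symmetric]) auto
  also have "\<dots> < (\<Sum>c'\<in>S. 2 * n * k)"
    using less fin \<open>S \<noteq> {}\<close> by (intro sum_strict_mono) auto
  also have "\<dots> = (n - 1) * (2 * n * k)" using cards by simp
  also have "\<dots> = card T * (2 * k)" using cards by (simp add: algebra_simps diff_mult_distrib)
  finally show False by simp
qed

section \<open>Exchanging two rows on some of the columns\<close>

text \<open>
  On a finite set it is enough that every symbol occurs: entries in range and uniqueness follow
  from the cardinality.
\<close>

lemma latin_arrayI:
  assumes "\<And>r. r < n \<Longrightarrow> {..<n} \<subseteq> B r ` {..<n}" "\<And>c. c < n \<Longrightarrow> {..<n} \<subseteq> (\<lambda>r. B r c) ` {..<n}"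
  shows "latin_array n B"
proof -
  have "f ` {..<n} = {..<n}" if "{..<n} \<subseteq> f ` {..<n}" for f :: "nat \<Rightarrow> nat"
    using card_seteq[OF _ that] card_image_le[of "{..<n}" f] by simp
  then show ?thesis using assms unfolding latin_array_def by simp
qed

lemma near_latinI:
  assumes "latin_array n B" "r < n" "e < n" "A r e \<noteq> B r e"
    and "differing n A B \<subseteq> D" "finite D" "card D \<le> b"
  shows "near_latin n A b"
  unfolding near_latin_def using assms card_mono[of D "differing n A B"]
  by (intro exI[of _ B]) (auto simp: differing_def)

lemma near_latin_mono: "near_latin n A b \<Longrightarrow> b \<le> b' \<Longrightarrow> near_latin n A b'"
  unfolding near_latin_def using le_trans by blast

lemma swap_cells_column:
  assumes "r < n" "r' < n"
  shows "(\<lambda>i. swap_cells r r' S A i e) ` {..<n} = (\<lambda>i. A i e) ` {..<n}"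
proof -
  have "Transposition.transpose r r' ` {..<n} = {..<n}"
    using assms by (intro permutes_image permutes_swap_id) auto
  then have "(\<lambda>i. A i e) ` {..<n} = (\<lambda>i. A i e) ` Transposition.transpose r r' ` {..<n}"
    by (simp only:)
  then show ?thesis by (cases "e \<in> S") (simp_all add: swap_cells_def image_image)
qed

lemma swap_cells_simps:
  "swap_cells r r' S A r e = A (if e \<in> S then r' else r) e"
  "swap_cells r r' S A r' e = A (if e \<in> S then r else r') e"
  "i \<notin> {r, r'} \<Longrightarrow> swap_cells r r' S A i = A i"
  by (auto simp: swap_cells_def transpose_apply_other)

lemma near_latin_row_swap:
  assumes L: "latin_array n A" and r: "r < n" "r' < n" "r \<noteq> r'"
    and S: "S \<subseteq> {..<n}" "S \<noteq> {}" "A r' ` S = A r ` S"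
  shows "near_latin n A (2 * card S)"
proof -
  let ?B = "swap_cells r r' S A"
  have rows: "A i ` {..<n} = {..<n}" and cols: "(\<lambda>i. A i e) ` {..<n} = {..<n}"
    if "i < n" "e < n" for i e
    using L that by (auto simp: latin_array_def)
  have N: "{..<n} = ({..<n} - S) \<union> S" using S(1) by blast
  have "latin_array n ?B"
  proof (rule latin_arrayI)
    fix i assume i: "i < n"
    have "?B i ` ({..<n} - S) = A i ` ({..<n} - S)"
      by (intro image_cong) (auto simp: swap_cells_def)
    moreover have "?B i ` S = A (Transposition.transpose r r' i) ` S"
      by (intro image_cong) (auto simp: swap_cells_def)
    moreover have "A (Transposition.transpose r r' i) ` S = A i ` S"
      using S(3) by (simp add: transpose_def)
    ultimately have "?B i ` {..<n} = A i ` {..<n}"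
      using N by (metis image_Un)
    then show "{..<n} \<subseteq> ?B i ` {..<n}" using rows[OF i i] by simp
  next
    fix e assume "e < n"
    then show "{..<n} \<subseteq> (\<lambda>i. ?B i e) ` {..<n}"
      using swap_cells_column[OF r(1,2)] cols by simp
  qed
  moreover obtain e where "e \<in> S" using S by auto
  moreover have "A r e \<noteq> A r' e" if "e \<in> S" for e
    using latin_array_inj(2)[OF L, of e] r S(1) that by (auto dest: inj_onD)
  moreover have "differing n A ?B \<subseteq> {r, r'} \<times> S"
    by (auto simp: differing_def swap_cells_def transpose_def split: if_splits)
  ultimately show ?thesis
    using r S(1) finite_subset[OF S(1)]
    by (intro near_latinI[of n ?B r e A "{r, r'} \<times> S"])
      (auto simp: card_cartesian_product swap_cells_simps)
qed

lemma near_latin_short_cycle: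
  assumes L: "latin_array n A" and "short_cycle n A b"
  shows "near_latin n A (2 * b)"
proof -
  obtain r r' e l where *: "r < n" "r' < n" "e < n" "r \<noteq> r'" "1 \<le> l" "l \<le> b"
    "(row_map n A r r' ^^ l) e = e"
    using assms by (auto simp: short_cycle_def)
  let ?S = "insert e ((\<lambda>j. (row_map n A r r' ^^ j) e) ` {1..<l})"
  have "A r' ` ?S = A r ` ?S"
    using orbit_link[where P = "A r" and Q = "A r'", OF row_map[OF L *(1,2)] *(3,5)] *(7) by simp
  moreover have "?S \<subseteq> {..<n}"
    using funpow_less[OF row_map(1)[OF L *(1,2)] *(3)] *(3) by auto
  ultimately have "near_latin n A (2 * card ?S)"
    using near_latin_row_swap[OF L *(1,2,4)] by blast
  moreover have "card ?S \<le> b"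
  proof -
    have "card ?S \<le> Suc (card ((\<lambda>j. (row_map n A r r' ^^ j) e) ` {1..<l}))"
      by (simp add: card_insert_if)
    also have "\<dots> \<le> Suc (l - 1)" using card_image_le[of "{1..<l}"] by simp
    finally show ?thesis using * by simp
  qed
  ultimately show ?thesis by (elim near_latin_mono) simp
qed

text \<open>
  What an exchange of two rows along a path leaves open in columns \<open>c\<close> and \<open>c'\<close>. The symbols of
  row \<open>r\<close> on \<open>I\<close> and \<open>c'\<close> are those of row \<open>r'\<close> on \<open>c\<close> and \<open>I\<close>; once row \<open>r\<close>
  holds the symbols of row \<open>r'\<close> on \<open>I\<close>, only \<open>A r' c\<close> and its own symbol \<open>A r c\<close> are missing in it.
\<close>

lemma link_swap_rows:
  assumes L: "latin_array n A" and r: "r < n" "r' < n" and lk: "link n A r r' c c' I"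
  shows "{..<n} \<subseteq> (\<lambda>e. A (if e \<in> I then r' else r) e) ` ({..<n} - {c, c'}) \<union> {A r c, A r' c}"
    and "{..<n} \<subseteq> (\<lambda>e. A (if e \<in> I then r else r') e) ` ({..<n} - {c, c'}) \<union> {A r c', A r' c'}"
proof -
  have I: "I \<subseteq> {..<n} - {c, c'}"
    using lk unfolding link_def by (rule conjunct1)
  have eq: "A r' ` insert c I = A r ` insert c' I"
    using lk unfolding link_def by (rule conjunct2)
  show "{..<n} \<subseteq> (\<lambda>e. A (if e \<in> I then r' else r) e) ` ({..<n} - {c, c'}) \<union> {A r c, A r' c}"
  proof
    fix s assume "s \<in> {..<n}"
    then have "s \<in> A r ` {..<n}" using L r by (simp add: latin_array_def)
    then obtain e where e: "e < n" "s = A r e" by auto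
    show "s \<in> (\<lambda>e. A (if e \<in> I then r' else r) e) ` ({..<n} - {c, c'}) \<union> {A r c, A r' c}"
    proof (cases "e \<in> insert c' I")
      case True
      then have "s \<in> A r' ` insert c I" using e unfolding eq by blast
      then obtain e' where "e' = c \<or> e' \<in> I" "s = A r' e'" by auto
      then show ?thesis using I by force
    qed (use e in force)
  qed
  show "{..<n} \<subseteq> (\<lambda>e. A (if e \<in> I then r else r') e) ` ({..<n} - {c, c'}) \<union> {A r c', A r' c'}"
  proof
    fix s assume "s \<in> {..<n}"
    then have "s \<in> A r' ` {..<n}" using L r by (simp add: latin_array_def)
    then obtain e where e: "e < n" "s = A r' e" by auto
    show "s \<in> (\<lambda>e. A (if e \<in> I then r else r') e) ` ({..<n} - {c, c'}) \<union> {A r c', A r' c'}"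
    proof (cases "e \<in> insert c I")
      case True
      then have "s \<in> A r ` insert c' I" using e unfolding eq[symmetric] by blast
      then obtain e' where "e' = c' \<or> e' \<in> I" "s = A r e'" by auto
      then show ?thesis using I by force
    qed (use e in force)
  qed
qed

text \<open>
  A stretch of rows from \<open>x\<close> to \<open>y\<close>: column \<open>c'\<close> on \<open>x\<close> and \<open>J\<close> has the symbols of column \<open>c\<close> on \<open>y\<close>
  and \<open>J\<close>. If the two columns are exchanged on \<open>J\<close>, column \<open>c\<close> has to make up only for \<open>A x c\<close> and
  \<open>A x c'\<close>, and column \<open>c'\<close> for \<open>A y c\<close> and \<open>A y c'\<close>.
\<close>

lemma link_transp:
  assumes "link n (transp A) c c' x y J"
  shows "x \<notin> J" "y \<notin> J" "J \<subseteq> {..<n}"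
    and "\<And>r. r \<in> insert y J \<Longrightarrow> \<exists>r'\<in>insert x J. A r c = A r' c'"
    and "\<And>r. r \<in> insert x J \<Longrightarrow> \<exists>r'\<in>insert y J. A r c' = A r' c"
proof -
  have "link n (\<lambda>i j. A j i) c c' x y J"
    using assms by (simp add: transp_def[abs_def])
  then have eq: "(\<lambda>r. A r c') ` insert x J = (\<lambda>r. A r c) ` insert y J"
    unfolding link_def by (rule conjunct2)
  show "J \<subseteq> {..<n}" "x \<notin> J" "y \<notin> J"
    using assms unfolding link_def by blast+
  show "\<exists>r'\<in>insert x J. A r c = A r' c'" if "r \<in> insert y J" for r
  proof -
    have "A r c \<in> (\<lambda>r. A r c) ` insert y J" using that by (rule imageI)
    then show ?thesis unfolding eq[symmetric] by blast
  qed
  show "\<exists>r'\<in>insert y J. A r c' = A r' c" if "r \<in> insert x J" for r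
  proof -
    have "A r c' \<in> (\<lambda>r. A r c') ` insert x J" using that by (rule imageI)
    then show ?thesis unfolding eq by blast
  qed
qed

section \<open>Refilling the two columns\<close>

lemma column_obtain:
  assumes "latin_array n A" "c < n" "s \<in> {..<n}"
  obtains r where "r < n" "s = A r c"
proof -
  have "s \<in> (\<lambda>r. A r c) ` {..<n}" using assms by (simp add: latin_array_def)
  then show thesis using that by auto
qed

lemma differing_subsetI:
  "(\<And>i e. A i e \<noteq> B i e \<Longrightarrow> (i, e) \<in> D) \<Longrightarrow> differing n A B \<subseteq> D"
  by (auto simp: differing_def)

lemma fillable_latin:
  assumes L: "latin_array n A" and c: "c < n" "c' < n"
  shows "fillable n c c' A (\<lambda>i. {A i c, A i c'})"
proof -
  have "{..<n} = ({..<n} - {c, c'}) \<union> {c, c'}" using c by auto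
  then have "A r ` {..<n} = A r ` ({..<n} - {c, c'}) \<union> {A r c, A r c'}" for r
    by (metis image_Un image_empty image_insert)
  then show ?thesis using L unfolding fillable_def latin_array_def by blast
qed

text \<open>
  Rows \<open>r\<close>, \<open>r'\<close> are still as in \<open>A\<close>, so the step can be repeated for disjoint pairs of rows.
\<close>

lemma fillable_swap:
  assumes L: "latin_array n A" and r: "r < n" "r' < n" "r \<noteq> r'"
    and lk: "link n A r r' c c' I" and M: "fillable n c c' M P" "M r = A r" "M r' = A r'"
  shows "fillable n c c' (swap_cells r r' I M) (P(r := {A r c, A r' c}, r' := {A r c', A r' c'}))"
    (is "fillable n c c' ?M ?P")
  unfolding fillable_def
proof (intro conjI allI impI)
  fix e assume "e < n" "e \<notin> {c, c'}"
  then show "{..<n} \<subseteq> (\<lambda>i. ?M i e) ` {..<n}"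
    using M(1) swap_cells_column[OF r(1,2)] by (simp add: fillable_def)
next
  fix i assume i: "i < n"
  consider "i = r" | "i = r'" | "i \<notin> {r, r'}" by blast
  then show "{..<n} \<subseteq> ?M i ` ({..<n} - {c, c'}) \<union> ?P i"
  proof cases
    case 1
    have "?M r = (\<lambda>e. A (if e \<in> I then r' else r) e)"
      using M by (auto simp: swap_cells_simps)
    then show ?thesis using link_swap_rows(1)[OF L r(1,2) lk] r(3) 1 by simp
  next
    case 2
    have "?M r' = (\<lambda>e. A (if e \<in> I then r else r') e)"
      using M by (auto simp: swap_cells_simps)
    then show ?thesis using link_swap_rows(2)[OF L r(1,2) lk] 2 by simp
  next
    case 3
    then show ?thesis using M(1) i by (simp add: fillable_def swap_cells_simps(3))
  qed
qed

lemma latin_array_fill: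
  assumes M: "fillable n c c' M P" and c: "c < n" "c' < n" "c \<noteq> c'"
    and fg: "{..<n} \<subseteq> f ` {..<n}" "{..<n} \<subseteq> g ` {..<n}" "\<And>i. i < n \<Longrightarrow> P i = {f i, g i}"
  shows "latin_array n (\<lambda>i. (M i)(c := f i, c' := g i))" (is "latin_array n ?B")
proof (rule latin_arrayI)
  fix i assume i: "i < n"
  have "M i ` ({..<n} - {c, c'}) = ?B i ` ({..<n} - {c, c'})"
    by (intro image_cong) auto
  moreover have "P i = ?B i ` {c, c'}" using fg(3)[OF i] c(3) by simp
  moreover have "{..<n} = ({..<n} - {c, c'}) \<union> {c, c'}" using c by auto
  ultimately have "M i ` ({..<n} - {c, c'}) \<union> P i = ?B i ` {..<n}"
    by (metis image_Un)
  moreover have "{..<n} \<subseteq> M i ` ({..<n} - {c, c'}) \<union> P i"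
    using M i by (simp add: fillable_def)
  ultimately show "{..<n} \<subseteq> ?B i ` {..<n}" by simp
next
  fix e assume e: "e < n"
  consider "e = c" | "e = c'" | "e \<notin> {c, c'}" by blast
  then show "{..<n} \<subseteq> (\<lambda>i. ?B i e) ` {..<n}"
  proof cases
    case 3
    then show ?thesis using M e by (simp add: fillable_def)
  qed (use fg c in simp_all)
qed

text \<open>
  A single move, for joined rows \<open>x\<close>, \<open>y\<close> that are close in the permutation of the rows: the stretch
  \<open>J\<close> between them is reversed. Whichever of the two rows has to receive the symbols of column \<open>c\<close>
  gets \<open>A x c\<close> there and \<open>A y c\<close> in column \<open>c'\<close>; the other row gets \<open>A x c'\<close> and \<open>A y c'\<close>.
\<close>

lemma near_latin_one_edge:
  assumes L: "latin_array n A" and c: "c < n" "c' < n" "c \<noteq> c'"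
    and xy: "x < n" "y < n" "x \<noteq> y"
    and jn: "joined n A k c c' x y" and lk: "link n (transp A) c c' x y J"
  shows "near_latin n A (2 * k + 2 * (card J + 2))"
proof -
  obtain r r' I where *: "r = x \<and> r' = y \<or> r = y \<and> r' = x" "link n A r r' c c' I" "I \<noteq> {}" "card I \<le> k"
    using joinedE[OF jn] .
  note J = link_transp[OF lk]
  have r: "r < n" "r' < n" "r \<noteq> r'" "r \<notin> J" "r' \<notin> J"
    using *(1) xy J(1,2) by blast+
  have rr: "{x, y} = {r, r'}" using *(1) by blast
  have I: "I \<subseteq> {..<n} - {c, c'}" using *(2) by (simp add: link_def)
  define M where "M = swap_cells r r' I A"
  define f where "f = (\<lambda>i. if i = r then A x c else if i = r' then A x c' else
    if i \<in> J then A i c' else A i c)"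
  define g where "g = (\<lambda>i. if i = r then A y c else if i = r' then A y c' else
    if i \<in> J then A i c else A i c')"
  define B where "B = (\<lambda>i. (M i)(c := f i, c' := g i))"
  have f: "f r = A x c" "f r' = A x c'" "\<And>i. i \<in> J \<Longrightarrow> f i = A i c'"
    "\<And>i. i \<notin> {r, r'} \<union> J \<Longrightarrow> f i = A i c"
    using r by (auto simp: f_def)
  have g: "g r = A y c" "g r' = A y c'" "\<And>i. i \<in> J \<Longrightarrow> g i = A i c"
    "\<And>i. i \<notin> {r, r'} \<union> J \<Longrightarrow> g i = A i c'"
    using r by (auto simp: g_def)
  have J_less: "i < n" if "i \<in> J" for i using J(3) that by auto
  have "latin_array n B"
    unfolding B_def
  proof (rule latin_array_fill[OF _ c])
    show "fillable n c c' M ((\<lambda>i. {A i c, A i c'})(r := {A r c, A r' c}, r' := {A r c', A r' c'}))"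
      unfolding M_def using fillable_swap[OF L r(1-3) *(2) fillable_latin[OF L c(1,2)]] by simp
    show "{..<n} \<subseteq> f ` {..<n}"
    proof
      fix s assume "s \<in> {..<n}"
      then obtain i where i: "i < n" "s = A i c" by (rule column_obtain[OF L c(1)])
      consider "i \<in> insert y J" | "i = x" | "i \<notin> {r, r'} \<union> J" using rr by blast
      then show "s \<in> f ` {..<n}"
      proof cases
        case 1
        then obtain i' where "i' \<in> insert x J" "s = A i' c'" using J(4) i by blast
        then have "s = f r' \<or> i' \<in> J \<and> s = f i'" using f(2,3) by auto
        then show ?thesis using J_less r by blast
      next
        case 2
        then have "s = f r" using i f(1) by simp
        then show ?thesis using r by blast
      next
        case 3
        then have "s = f i" using i f(4) by simp
        then show ?thesis using i by blast
      qed
    qed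
    show "{..<n} \<subseteq> g ` {..<n}"
    proof
      fix s assume "s \<in> {..<n}"
      then obtain i where i: "i < n" "s = A i c'" by (rule column_obtain[OF L c(2)])
      consider "i \<in> insert x J" | "i = y" | "i \<notin> {r, r'} \<union> J" using rr by blast
      then show "s \<in> g ` {..<n}"
      proof cases
        case 1
        then obtain i' where "i' \<in> insert y J" "s = A i' c" using J(5) i by blast
        then have "s = g r \<or> i' \<in> J \<and> s = g i'" using g(1,3) by auto
        then show ?thesis using J_less r by blast
      next
        case 2
        then have "s = g r'" using i g(2) by simp
        then show ?thesis using r by blast
      next
        case 3
        then have "s = g i" using i g(4) by simp
        then show ?thesis using i by blast
      qed
    qed
    fix i
    have "{A r c, A r' c} = {f r, g r}" "{A r c', A r' c'} = {f r', g r'}"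
      using *(1) f(1,2) g(1,2) by auto
    then show "((\<lambda>i. {A i c, A i c'})(r := {A r c, A r' c}, r' := {A r c', A r' c'})) i = {f i, g i}"
      by (auto simp: f_def g_def)
  qed
  moreover obtain e where e: "e \<in> I" using *(3) by auto
  moreover have "A r e \<noteq> B r e"
    using latin_array_inj(2)[OF L, of e] r e I
    by (auto simp: B_def M_def swap_cells_simps dest: inj_onD)
  moreover have "differing n A B \<subseteq> {r, r'} \<times> I \<union> ({x, y} \<union> J) \<times> {c, c'}"
    unfolding rr
  proof (rule differing_subsetI, rule UnCI)
    fix i e assume ne: "A i e \<noteq> B i e" and out: "(i, e) \<notin> ({r, r'} \<union> J) \<times> {c, c'}"
    show "(i, e) \<in> {r, r'} \<times> I"
    proof (cases "e \<in> {c, c'}")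
      case True
      then have "B i e = A i e" using out f(4)[of i] g(4)[of i] c(3) by (auto simp: B_def)
      then show ?thesis using ne by simp
    next
      case False
      then have "B i e = M i e" by (simp add: B_def)
      then show ?thesis using ne transpose_apply_other[of i r r']
        unfolding M_def swap_cells_def by (cases "e \<in> I"; cases "i \<in> {r, r'}") simp_all
    qed
  qed
  moreover have "finite ({r, r'} \<times> I \<union> ({x, y} \<union> J) \<times> {c, c'})"
    using finite_subset[OF I] finite_subset[OF J(3)] by auto
  moreover have "card ({r, r'} \<times> I \<union> ({x, y} \<union> J) \<times> {c, c'}) \<le> 2 * k + 2 * (card J + 2)"
  proof -
    have "card ({r, r'} \<times> I \<union> ({x, y} \<union> J) \<times> {c, c'})
        \<le> card ({r, r'} \<times> I) + card (({x, y} \<union> J) \<times> {c, c'})"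
      by (rule card_Un_le)
    also have "card ({r, r'} \<times> I) = 2 * card I" for I :: "nat set"
      using r(3) by (simp add: card_cartesian_product)
    also have "card (X \<times> {c, c'}) = 2 * card X" for X :: "nat set"
      using c(3) by (simp add: card_cartesian_product)
    also have "card ({x, y} \<union> J) \<le> card {x, y} + card J" by (rule card_Un_le)
    finally show ?thesis using *(4) xy(3) by simp
  qed
  moreover have "e < n" using e I by auto
  ultimately show ?thesis
    using near_latinI[of n B r e A] r(1) by (simp only: simp_thms)
qed

text \<open>
  Two moves at once. The stretches \<open>J1\<close> and \<open>J2\<close> lead from \<open>x1\<close> to \<open>y2\<close> and from \<open>x2\<close> to \<open>y1\<close>, across
  the two joined pairs. This is where the reversals of the two moves cancel: column \<open>c\<close> has to make
  up for the symbols of \<open>x1\<close> and \<open>x2\<close>, and column \<open>c'\<close> for those of \<open>y1\<close> and \<open>y2\<close>, and each joined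
  pair \<open>{x, y}\<close> can be refilled with the \<open>x\<close>-symbols in column \<open>c\<close> and the \<open>y\<close>-symbols in column
  \<open>c'\<close>, as in a single move.
\<close>

lemma near_latin_two_edges:
  assumes L: "latin_array n A" and c: "c < n" "c' < n" "c \<noteq> c'"
    and xy: "x1 < n" "y1 < n" "x2 < n" "y2 < n" "distinct [x1, y1, x2, y2]"
    and jn: "joined n A k c c' x1 y1" "joined n A k c c' x2 y2"
    and lk: "link n (transp A) c c' x1 y2 J1" "link n (transp A) c c' x2 y1 J2"
    and disj: "x2 \<notin> J1" "y1 \<notin> J1" "x1 \<notin> J2" "y2 \<notin> J2"
  shows "near_latin n A (4 * k + 2 * (card J1 + card J2 + 4))"
proof -
  obtain r1 r1' I1 where 1: "r1 = x1 \<and> r1' = y1 \<or> r1 = y1 \<and> r1' = x1"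
    "link n A r1 r1' c c' I1" "I1 \<noteq> {}" "card I1 \<le> k"
    using joinedE[OF jn(1)] .
  obtain r2 r2' I2 where 2: "r2 = x2 \<and> r2' = y2 \<or> r2 = y2 \<and> r2' = x2"
    "link n A r2 r2' c c' I2" "card I2 \<le> k"
    using joinedE[OF jn(2)] .
  note J1 = link_transp[OF lk(1)] and J2 = link_transp[OF lk(2)]
  define E where "E = {r1, r1', r2, r2'}"
  define J where "J = J1 \<union> J2"
  have rr1: "{x1, y1} = {r1, r1'}" and rr2: "{x2, y2} = {r2, r2'}" using 1(1) 2(1) by blast+
  have E_eq: "E = {x1, y1} \<union> {x2, y2}" unfolding E_def rr1 rr2 by blast
  have r: "r1 < n" "r1' < n" "r2 < n" "r2' < n"
    using xy(1-4) 1(1) 2(1) by blast+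
  have dist: "distinct [r1, r1', r2, r2']"
    using xy(5) 1(1) 2(1) by auto
  have EJ: "E \<inter> J = {}"
    unfolding E_eq J_def using J1(1,2) J2(1,2) disj by blast
  have I: "I1 \<subseteq> {..<n} - {c, c'}" "I2 \<subseteq> {..<n} - {c, c'}"
    using 1(2) 2(2) by (simp_all add: link_def)
  have J_less: "i < n" if "i \<in> J" for i using J1(3) J2(3) that by (auto simp: J_def)
  define M1 where "M1 = swap_cells r1 r1' I1 A"
  define M where "M = swap_cells r2 r2' I2 M1"
  define f where "f = (\<lambda>i. if i = r1 then A x1 c else if i = r1' then A x1 c' else
    if i = r2 then A x2 c else if i = r2' then A x2 c' else if i \<in> J then A i c' else A i c)"
  define g where "g = (\<lambda>i. if i = r1 then A y1 c else if i = r1' then A y1 c' else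
    if i = r2 then A y2 c else if i = r2' then A y2 c' else if i \<in> J then A i c else A i c')"
  define B where "B = (\<lambda>i. (M i)(c := f i, c' := g i))"
  have f: "f r1 = A x1 c" "f r1' = A x1 c'" "f r2 = A x2 c" "f r2' = A x2 c'"
    "\<And>i. i \<in> J \<Longrightarrow> f i = A i c'" "\<And>i. i \<notin> E \<union> J \<Longrightarrow> f i = A i c"
    using dist EJ by (auto simp: f_def E_def)
  have g: "g r1 = A y1 c" "g r1' = A y1 c'" "g r2 = A y2 c" "g r2' = A y2 c'"
    "\<And>i. i \<in> J \<Longrightarrow> g i = A i c" "\<And>i. i \<notin> E \<union> J \<Longrightarrow> g i = A i c'"
    using dist EJ by (auto simp: g_def E_def)
  have "latin_array n B"
    unfolding B_def
  proof (rule latin_array_fill[OF _ c])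
    have M1: "fillable n c c' M1 ((\<lambda>i. {A i c, A i c'})
        (r1 := {A r1 c, A r1' c}, r1' := {A r1 c', A r1' c'}))"
      unfolding M1_def using dist
      by (intro fillable_swap[OF L r(1,2) _ 1(2) fillable_latin[OF L c(1,2)]]) auto
    show "fillable n c c' M ((\<lambda>i. {A i c, A i c'})
        (r1 := {A r1 c, A r1' c}, r1' := {A r1 c', A r1' c'},
         r2 := {A r2 c, A r2' c}, r2' := {A r2 c', A r2' c'}))"
      unfolding M_def
    proof (rule fillable_swap[OF L r(3,4) _ 2(2) M1])
      show "M1 r2 = A r2" "M1 r2' = A r2'" "r2 \<noteq> r2'"
        unfolding M1_def using dist by (auto simp: swap_cells_simps(3))
    qed
    show "{..<n} \<subseteq> f ` {..<n}"
    proof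
      fix s assume "s \<in> {..<n}"
      then obtain i where i: "i < n" "s = A i c" by (rule column_obtain[OF L c(1)])
      consider "i \<in> insert y2 J1" | "i \<in> insert y1 J2" | "i = x1" | "i = x2" | "i \<notin> E \<union> J"
        unfolding E_eq J_def by blast
      then have "s = f r1 \<or> s = f r1' \<or> s = f r2 \<or> s = f r2' \<or> (\<exists>i<n. s = f i)"
      proof cases
        case 1
        then obtain i' where "i' \<in> insert x1 J1" "s = A i' c'" using J1(4) i(2) by blast
        then have "s = f r1' \<or> i' \<in> J \<and> s = f i'" using f(2,5) by (auto simp: J_def)
        then show ?thesis using J_less by blast
      next
        case 2
        then obtain i' where "i' \<in> insert x2 J2" "s = A i' c'" using J2(4) i(2) by blast
        then have "s = f r2' \<or> i' \<in> J \<and> s = f i'" using f(4,5) by (auto simp: J_def)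
        then show ?thesis using J_less by blast
      next
        case 5
        then show ?thesis using f(6) i by auto
      qed (simp_all add: i(2) f(1,3))
      then show "s \<in> f ` {..<n}" using r by blast
    qed
    show "{..<n} \<subseteq> g ` {..<n}"
    proof
      fix s assume "s \<in> {..<n}"
      then obtain i where i: "i < n" "s = A i c'" by (rule column_obtain[OF L c(2)])
      consider "i \<in> insert x1 J1" | "i \<in> insert x2 J2" | "i = y1" | "i = y2" | "i \<notin> E \<union> J"
        unfolding E_eq J_def by blast
      then have "s = g r1 \<or> s = g r1' \<or> s = g r2 \<or> s = g r2' \<or> (\<exists>i<n. s = g i)"
      proof cases
        case 1
        then obtain i' where "i' \<in> insert y2 J1" "s = A i' c" using J1(5) i(2) by blast
        then have "s = g r2 \<or> i' \<in> J \<and> s = g i'" using g(3,5) by (auto simp: J_def)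
        then show ?thesis using J_less by blast
      next
        case 2
        then obtain i' where "i' \<in> insert y1 J2" "s = A i' c" using J2(5) i(2) by blast
        then have "s = g r1 \<or> i' \<in> J \<and> s = g i'" using g(1,5) by (auto simp: J_def)
        then show ?thesis using J_less by blast
      next
        case 5
        then show ?thesis using g(6) i by auto
      qed (simp_all add: i(2) g(2,4))
      then show "s \<in> g ` {..<n}" using r by blast
    qed
    fix i
    have "{A r1 c, A r1' c} = {f r1, g r1}" "{A r1 c', A r1' c'} = {f r1', g r1'}"
      using 1(1) f(1,2) g(1,2) by auto
    moreover have "{A r2 c, A r2' c} = {f r2, g r2}" "{A r2 c', A r2' c'} = {f r2', g r2'}"
      using 2(1) f(3,4) g(3,4) by auto
    moreover have "{A i c, A i c'} = {f i, g i}" if "i \<notin> E"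
      using that f(5,6)[of i] g(5,6)[of i] by (cases "i \<in> J") auto
    ultimately show "((\<lambda>i. {A i c, A i c'})
        (r1 := {A r1 c, A r1' c}, r1' := {A r1 c', A r1' c'},
         r2 := {A r2 c, A r2' c}, r2' := {A r2 c', A r2' c'})) i = {f i, g i}"
      by (simp add: E_def)
  qed
  moreover obtain e where e: "e \<in> I1" using 1(3) by auto
  moreover have "A r1 e \<noteq> B r1 e"
  proof -
    have "B r1 e = M r1 e" using e I by (auto simp: B_def)
    also have "\<dots> = A r1' e"
      using dist e by (simp add: M_def M1_def swap_cells_simps)
    finally show ?thesis
      using latin_array_inj(2)[OF L, of e] r dist e I by (auto dest: inj_onD)
  qed
  moreover define D where "D = {r1, r1'} \<times> I1 \<union> {r2, r2'} \<times> I2 \<union> (E \<union> J) \<times> {c, c'}"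
  have "differing n A B \<subseteq> D"
    unfolding D_def
  proof (rule differing_subsetI, rule UnCI)
    fix i e assume ne: "A i e \<noteq> B i e" and out: "(i, e) \<notin> (E \<union> J) \<times> {c, c'}"
    show "(i, e) \<in> {r1, r1'} \<times> I1 \<union> {r2, r2'} \<times> I2"
    proof (cases "e \<in> {c, c'}")
      case True
      then have "B i e = A i e" using out f(6)[of i] g(6)[of i] c(3) by (auto simp: B_def)
      then show ?thesis using ne by simp
    next
      case False
      then have "B i e = M i e" by (simp add: B_def)
      moreover have "M i e = M1 i e" if "(i, e) \<notin> {r2, r2'} \<times> I2"
        unfolding M_def swap_cells_def using that
        by (cases "e \<in> I2"; cases "i \<in> {r2, r2'}") simp_all
      moreover have "M1 i e = A i e" if "(i, e) \<notin> {r1, r1'} \<times> I1"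
        unfolding M1_def swap_cells_def using that
        by (cases "e \<in> I1"; cases "i \<in> {r1, r1'}") simp_all
      ultimately show ?thesis using ne by (metis UnCI)
    qed
  qed
  moreover have "finite D"
    using finite_subset[OF I(1)] finite_subset[OF I(2)] finite_subset[OF J1(3)] finite_subset[OF J2(3)]
    by (simp add: D_def E_def J_def)
  moreover have "card D \<le> 4 * k + 2 * (card J1 + card J2 + 4)"
  proof -
    have "card D \<le> card ({r1, r1'} \<times> I1 \<union> {r2, r2'} \<times> I2) + card ((E \<union> J) \<times> {c, c'})"
      unfolding D_def by (rule card_Un_le)
    also have "card ((E \<union> J) \<times> {c, c'}) = 2 * card (E \<union> J)"
      using c(3) by (simp add: card_cartesian_product)
    also have "card ({r1, r1'} \<times> I1 \<union> {r2, r2'} \<times> I2) \<le> card ({r1, r1'} \<times> I1) + card ({r2, r2'} \<times> I2)"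
      by (rule card_Un_le)
    also have "card ({r1, r1'} \<times> I) = 2 * card I" for I :: "nat set"
      using dist by (simp add: card_cartesian_product)
    also have "card ({r2, r2'} \<times> I) = 2 * card I" for I :: "nat set"
      using dist by (simp add: card_cartesian_product)
    finally have "card D \<le> 2 * card I1 + 2 * card I2 + 2 * card (E \<union> J)" by simp
    moreover have "card (E \<union> J) \<le> card E + card J" by (rule card_Un_le)
    moreover have "card J \<le> card J1 + card J2" unfolding J_def by (rule card_Un_le)
    moreover have "card E = 4" using dist by (simp add: E_def)
    ultimately show ?thesis using 1(4) 2(3) by simp
  qed
  moreover have "e < n" using e I by auto
  ultimately show ?thesis
    using near_latinI[of n B r1 e A D] r(1) by (simp only: simp_thms)
qed

section \<open>The bound\<close>

text \<open>
  A cycle of length at most \<open>2k + 2\<close> costs at most \<open>4k + 4 \<le> 8k\<close> cells. If there is none, the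
  pigeonhole argument gives \<open>(u, v)\<close> and \<open>(u', v')\<close> with stretches of \<open>d < k\<close> steps from \<open>u\<close> to
  \<open>u'\<close> and from \<open>v'\<close> to \<open>v\<close>. If the stretches are disjoint, both moves are made, at a cost of
  \<open>4k + 4(d + 1) \<le> 8k\<close> cells. If they meet, \<open>v\<close> is at most \<open>2d\<close> steps after \<open>u\<close>, and the move for
  \<open>u\<close>, \<open>v\<close> alone costs at most \<open>2k + 2(2d + 1) \<le> 8k\<close>.
\<close>

lemma near_latin_bound:
  assumes L: "latin_array n A" and n: "2 \<le> n" and k: "1 \<le> k" "n < 2 * k * k"
  shows "near_latin n A (8 * k)"
proof (cases "short_cycle n A (2 * k + 2) \<or> short_cycle n (transp A) (2 * k + 2)")
  case True
  then have "near_latin n A (2 * (2 * k + 2)) \<or> near_latin n (transp A) (2 * (2 * k + 2))"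
    using near_latin_short_cycle L latin_array_transp by blast
  then have "near_latin n A (2 * (2 * k + 2))"
    using near_latin_transp by blast
  then show ?thesis by (rule near_latin_mono) (use k in simp)
next
  case False
  then have ns: "\<not> short_cycle n A (2 * k + 2)" "\<not> short_cycle n (transp A) (2 * k + 2)"
    by blast+
  have LT: "latin_array n (transp A)" using L by (simp add: latin_array_transp)
  \<comment> \<open>any column serves as the starting point of the count\<close>
  define c :: nat where "c = 0"
  have c: "c < n" using n by (simp add: c_def)
  define E where "E c' = {(r, r'). r < n \<and> r' < n \<and> r \<noteq> r' \<and> joined n A k c c' r r'}" for c'
  obtain c' where c': "c' < n" "c' \<noteq> c" "2 * n * k \<le> card (E c')"
    using many_joined_pairs[OF L c n ns(1)] unfolding E_def by blast
  define \<pi> where "\<pi> = row_map n (transp A) c c'"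
  have bij: "bij_betw \<pi> {..<n} {..<n}"
    unfolding \<pi>_def by (rule row_map(1)[OF LT c c'(1)])
  have no_cycle: "(\<pi> ^^ l) e \<noteq> e" if "e < n" "1 \<le> l" "l \<le> 2 * k + 2" for e l
    using ns(2) that c c' unfolding short_cycle_def \<pi>_def by blast
  have path: "link n (transp A) c c' u ((\<pi> ^^ d) u) ((\<lambda>j. (\<pi> ^^ j) u) ` {1..<d})"
    if "u < n" "1 \<le> d" "d \<le> 2 * k + 2" for u d
    unfolding \<pi>_def by (rule link_of_orbit[OF LT c c'(1) c'(2)[symmetric] that(1) ns(2) that(2,3)])
  have path_card: "card ((\<lambda>j. (\<pi> ^^ j) u) ` {1..<d}) + 1 \<le> d" if "1 \<le> d" for u d
    using card_image_le[of "{1..<d}" "\<lambda>j. (\<pi> ^^ j) u"] that by simp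
  have "n * n < 2 * n * k * k" using n k(2) by (simp add: algebra_simps)
  also have "\<dots> \<le> card (E c') * k" using c'(3) by simp
  finally have "n * n < card (E c') * (k - 1 + 1)" using k by simp
  moreover have "E c' \<subseteq> {..<n} \<times> {..<n}" by (auto simp: E_def)
  ultimately obtain u v u' v' d where uv: "(u, v) \<in> E c'" "(u', v') \<in> E c'"
    "1 \<le> d" "d \<le> k - 1" "u' = (\<pi> ^^ d) u" "v = (\<pi> ^^ d) v'"
    using antiparallel_pair[OF bij] by metis
  have less: "u < n" "v < n" "u' < n" "v' < n" "u \<noteq> v" "u' \<noteq> v'"
    and jn: "joined n A k c c' u v" "joined n A k c c' u' v'"
    using uv(1,2) by (simp_all add: E_def)
  have dk: "d + 1 \<le> k" using uv(4) k(1) by simp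
  show ?thesis
  proof (cases "\<exists>e. 1 \<le> e \<and> e \<le> 2 * d \<and> v = (\<pi> ^^ e) u")
    case True
    then obtain e where e: "1 \<le> e" "e \<le> 2 * d" "v = (\<pi> ^^ e) u" by blast
    let ?J = "(\<lambda>j. (\<pi> ^^ j) u) ` {1..<e}"
    have "link n (transp A) c c' u v ?J"
      unfolding e(3) using uv(4) e k by (intro path less(1)) auto
    then have "near_latin n A (2 * k + 2 * (card ?J + 2))"
      by (rule near_latin_one_edge[OF L c c'(1) c'(2)[symmetric] less(1,2,5) jn(1)])
    then show ?thesis
      by (rule near_latin_mono) (use path_card[OF e(1), of u] e dk in simp)
  next
    case False
    \<comment> \<open>a common row of the two stretches would put \<open>v\<close> at distance at most \<open>2 * d\<close> after \<open>u\<close>\<close>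
    have apart: "(\<pi> ^^ i) u \<noteq> (\<pi> ^^ j) v'" if "i \<le> d" "j \<le> d" for i j
    proof
      assume eq: "(\<pi> ^^ i) u = (\<pi> ^^ j) v'"
      have "(\<pi> ^^ (i + (d - j))) u = (\<pi> ^^ (d - j)) ((\<pi> ^^ i) u)"
        by (simp add: funpow_add add.commute[of i])
      also have "\<dots> = (\<pi> ^^ (d - j + j)) v'"
        unfolding eq by (simp only: funpow_add comp_apply)
      also have "\<dots> = v" using that uv(6) by simp
      finally have v_eq: "v = (\<pi> ^^ (i + (d - j))) u" by simp
      moreover have "i + (d - j) \<noteq> 0" using v_eq less(5) by (metis funpow_0)
      then have "1 \<le> i + (d - j)" by linarith
      moreover have "i + (d - j) \<le> 2 * d" using that by simp
      ultimately show False using False by blast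
    qed
    let ?J1 = "(\<lambda>j. (\<pi> ^^ j) u) ` {1..<d}" and ?J2 = "(\<lambda>j. (\<pi> ^^ j) v') ` {1..<d}"
    have "d \<le> 2 * k + 2" using dk by simp
    note lk = path[OF less(1) uv(3) this, folded uv(5)] path[OF less(4) uv(3) this, folded uv(6)]
    have "u \<noteq> u'" "v \<noteq> v'"
      using no_cycle[OF less(1) uv(3)] no_cycle[OF less(4) uv(3)] uv(5,6) dk by auto
    moreover have "u \<noteq> v'" "u' \<noteq> v"
      using apart[of 0 0] apart[of d d, folded uv(5,6)] by simp_all
    ultimately have dist: "distinct [u, v, v', u']" using less(5,6) by auto
    have ends: "(\<pi> ^^ j) u \<noteq> v'" "(\<pi> ^^ j) u \<noteq> v" "(\<pi> ^^ j) v' \<noteq> u" "(\<pi> ^^ j) v' \<noteq> u'"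
      if "j < d" for j
      using apart[of j 0] apart[of j d] apart[of 0 j] apart[of d j] that uv(5,6) by auto
    have "v' \<notin> ?J1" "v \<notin> ?J1" "u \<notin> ?J2" "u' \<notin> ?J2"
      using ends by (metis (no_types, lifting) imageE atLeastLessThan_iff)+
    moreover have "joined n A k c c' v' u'" using jn(2) joined_sym by blast
    ultimately have "near_latin n A (4 * k + 2 * (card ?J1 + card ?J2 + 4))"
      using near_latin_two_edges[OF L c c'(1) c'(2)[symmetric] less(1,2,4,3) dist jn(1) _ lk] by blast
    then show ?thesis
      by (rule near_latin_mono) (use path_card[OF uv(3), of u] path_card[OF uv(3), of v'] dk in simp)
  qed
qed

text \<open>
  For \<open>k = \<lfloor>\<surd>n\<rfloor>\<close> one has \<open>n \<le> k\<^sup>2 + 2k\<close>, which is less than \<open>2k\<^sup>2\<close> when \<open>k > 2\<close>. The direct argument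
  by two complete rows, with \<open>2n\<close> changed cells, works exactly as long as \<open>\<surd>n \<le> 4\<close>.
\<close>

lemma near_latin_sqrt:
  assumes L: "latin_array n A" and n: "2 \<le> n"
  shows "\<exists>b. near_latin n A b \<and> real b \<le> 8 * sqrt (real n)"
proof (cases "n \<le> 16")
  case True
  have "A 1 ` {..<n} = A 0 ` {..<n}" using L n by (simp add: latin_array_def)
  then have "near_latin n A (2 * card {..<n})"
    using n by (intro near_latin_row_swap[OF L, of 0 1]) (auto simp: lessThan_empty_iff)
  moreover have "sqrt (real n) \<le> 4" using True by (intro real_le_lsqrt) auto
  then have "sqrt (real n) * sqrt (real n) \<le> 4 * sqrt (real n)"
    by (intro mult_right_mono) auto
  then have "real (2 * card {..<n}) \<le> 8 * sqrt (real n)" by simp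
  ultimately show ?thesis by blast
next
  case False
  define k where "k = nat \<lfloor>sqrt (real n)\<rfloor>"
  have k_le: "real k \<le> sqrt (real n)" and k_gt: "sqrt (real n) < real k + 1"
    unfolding k_def by (simp_all add: of_nat_nat)
  have "4 < sqrt (real n)" using False by (intro real_less_rsqrt) auto
  then have "4 \<le> k" using k_gt by linarith
  have "real n < (real k + 1)\<^sup>2"
    using k_gt power_strict_mono[of "sqrt (real n)" "real k + 1" 2] by simp
  then have "real n < real ((k + 1) * (k + 1))" by (simp add: power2_eq_square algebra_simps)
  then have "n < (k + 1) * (k + 1)" by linarith
  also have "\<dots> = k * k + 2 * k + 1" by (simp add: algebra_simps)
  also have "\<dots> \<le> k * k + 4 * k" using \<open>4 \<le> k\<close> by simp
  also have "\<dots> \<le> 2 * k * k" using mult_right_mono[OF \<open>4 \<le> k\<close>, of k] by simp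
  finally have "near_latin n A (8 * k)"
    using near_latin_bound[OF L n] \<open>4 \<le> k\<close> by simp
  moreover have "real (8 * k) \<le> 8 * sqrt (real n)" using k_le by simp
  ultimately show ?thesis by blast
qed

section \<open>Arrays and sets of triples\<close>

definition triples :: "nat \<Rightarrow> (nat \<Rightarrow> nat \<Rightarrow> nat) \<Rightarrow> (nat \<times> nat \<times> nat) set" where
  "triples n A = {(i, j, k). i < n \<and> j < n \<and> k = A i j}"

lemma latin_square_triples:
  assumes L: "latin_array n A"
  shows "latin_square n (triples n A)"
  unfolding latin_square_def
proof (intro conjI allI impI)
  show "triples n A \<subseteq> {..<n} \<times> {..<n} \<times> {..<n}"
    using latin_array_less[OF L] by (auto simp: triples_def)
  show "\<exists>!k. (i, j, k) \<in> triples n A" if "i < n" "j < n" for i j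
    using that by (auto simp: triples_def)
  show "\<exists>!j. (i, j, k) \<in> triples n A" if "i < n" "k < n" for i k
  proof -
    have "k \<in> A i ` {..<n}" using L that by (simp add: latin_array_def)
    then show ?thesis
      using latin_array_inj(1)[OF L that(1)] that by (auto simp: triples_def dest: inj_onD)
  qed
  show "\<exists>!i. (i, j, k) \<in> triples n A" if "j < n" "k < n" for j k
  proof -
    have "k \<in> (\<lambda>i. A i j) ` {..<n}" using L that by (simp add: latin_array_def)
    then show ?thesis
      using latin_array_inj(2)[OF L that(1)] that by (auto simp: triples_def dest: inj_onD)
  qed
qed

lemma latin_square_obtain_array:
  assumes L: "latin_square n L"
  obtains A where "latin_array n A" "L = triples n A"
proof
  define A where "A i j = (THE k. (i, j, k) \<in> L)" for i j
  have sub: "L \<subseteq> {..<n} \<times> {..<n} \<times> {..<n}" and ex1: "\<And>i j. i < n \<Longrightarrow> j < n \<Longrightarrow> \<exists>!k. (i, j, k) \<in> L"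
    and row: "\<And>i k. i < n \<Longrightarrow> k < n \<Longrightarrow> \<exists>!j. (i, j, k) \<in> L"
    and col: "\<And>j k. j < n \<Longrightarrow> k < n \<Longrightarrow> \<exists>!i. (i, j, k) \<in> L"
    using L by (simp_all add: latin_square_def)
  have A: "A i j = k" if "(i, j, k) \<in> L" for i j k
  proof -
    have "i < n" "j < n" using sub that by auto
    then show ?thesis unfolding A_def using the1_equality[OF ex1] that by blast
  qed
  have A_in: "(i, j, A i j) \<in> L" if "i < n" "j < n" for i j
    using theI'[OF ex1[OF that]] by (simp add: A_def)
  show "L = triples n A"
    using sub A A_in by (fastforce simp: triples_def)
  show "latin_array n A"
  proof (rule latin_arrayI; rule subsetI)
    fix i k assume "i < n" "k \<in> {..<n}"
    then obtain j where "(i, j, k) \<in> L" using row[of i k] by auto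
    then show "k \<in> A i ` {..<n}" using sub A by force
  next
    fix j k assume "j < n" "k \<in> {..<n}"
    then obtain i where "(i, j, k) \<in> L" using col[of j k] by auto
    then show "k \<in> (\<lambda>i. A i j) ` {..<n}" using sub A by force
  qed
qed

theorem theorem1p1:
  fixes n :: nat and L :: "(nat \<times> nat \<times> nat) set"
  assumes "n \<ge> 2" and "latin_square n L"
  shows "\<exists>L'. latin_square n L' \<and> L' \<noteq> L \<and> real (card (L - L')) \<le> 8 * sqrt (real n)"
proof -
  obtain A where A: "latin_array n A" "L = triples n A"
    using latin_square_obtain_array[OF assms(2)] .
  obtain b where b: "near_latin n A b" "real b \<le> 8 * sqrt (real n)"
    using near_latin_sqrt[OF A(1) assms(1)] by blast
  obtain B where B: "latin_array n B" "differing n A B \<noteq> {}" "card (differing n A B) \<le> b"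
    using b(1) by (auto simp: near_latin_def)
  have diff: "L - triples n B = (\<lambda>(i, j). (i, j, A i j)) ` differing n A B"
    by (auto simp: A(2) triples_def differing_def)
  have "card (L - triples n B) = card (differing n A B)"
    unfolding diff by (rule card_image) (auto simp: inj_on_def)
  moreover have "triples n B \<noteq> L" using diff B(2) by auto
  ultimately show ?thesis
    using latin_square_triples[OF B(1)] B(3) b(2) by (intro exI[of _ "triples n B"]) auto
qed

end
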